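(* Let $k\ge 1$, $p_1,\dots,p_k\in\mathbb{N}_0$, $m_1\in\mathbb{N}_0$, $m_2,\dots,m_{k+1}\in\mathbb{N}$, and $a\in[-1,0)\cup(0,1)$. Put $P=p_1+\cdots+p_k$, $M=m_1+\cdots+m_{k+1}$, $\mathbf p_0=0$ and $\mathbf p_i=p_{k+1-i}+\cdots+p_k$ for $1\le i\le k$. Define $\eta(1)=1$, $\eta(a)=-a$. Then $$\mathrm{Li}_{\{1\}_{m_1},p_1+1,\{1\}_{m_2-1},\dots,p_k+1,\{1\}_{m_{k+1}-1}}(a)=\sum_{(\sigma_1,\dots,\sigma_P)\in\{1,a\}^P}\Big(\prod_{j=1}^{P}\frac{\eta(\sigma_j)}{\sigma_j}\Big)\,\mathrm{Li}_{\{1\}_{M+P}}\big(z(\sigma)\big),$$ where $z(\sigma)$ is the sequence (of length $M+P$) $$\big(a,\{1\}_{m_{k+1}-1},B_1,\{1\}_{m_k-1},B_2,\{1\}_{m_{k-1}-1},\dots,B_k,\{1\}_{m_1-1}\big),$$ with, for $1\le i\le k$: $B_i=\big(\tfrac{\sigma_{\mathbf p_{i-1}+1}}{a},\tfrac{\sigma_{\mathbf p_{i-1}+2}}{\sigma_{\mathbf p_{i-1}+1}},\dots,\tfrac{\sigma_{\mathbf p_i}}{\sigma_{\mathbf p_i-1}},\tfrac{a}{\sigma_{\mathbf p_i}}\big)$ if $p_{k+1-i}\ge 2$, $B_i=\big(\tfrac{\sigma_{\mathbf p_{i-1}+1}}{a},\tfrac{a}{\sigma_{\mathbf p_{i}}}\big)$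 if $p_{k+1-i}=1$, and $B_i=(1)$ if $p_{k+1-i}=0$. If $m_1=0$, the final block "$\{1\}_{m_1-1}=\{1\}_{-1}$" means that the last entry of $B_k$ is deleted (so the sequence ends with $\dots,\tfrac{\sigma_{\mathbf p_k}}{\sigma_{\mathbf p_k-1}}$ if $p_1\ge2$, with $\dots,\tfrac{\sigma_{\mathbf p_{k-1}+1}}{a}$ if $p_1=1$, and $B_k$ disappears entirely if $p_1=0$).
   Context: Multiple polylogarithms: $\mathrm{Li}_{s_1,\dots,s_r}(z_1,\dots,z_r)=\sum_{n_1>n_2>\cdots>n_r\ge1}\frac{z_1^{n_1}z_2^{n_2}\cdots z_r^{n_r}}{n_1^{s_1}\cdots n_r^{s_r}}$, and the one-variable version $\mathrm{Li}_{s_1,\dots,s_r}(z)=\mathrm{Li}_{s_1,\dots,s_r}(z,1,\dots,1)$. $\{1\}_d$ denotes $d$ consecutive entries equal to $1$ (empty if $d=0$); if $m_1=0$ the index on the left begins with $p_1+1$. *)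

theory Defs
  imports "HOL-Analysis.Analysis"
begin

definition decreasing_indices :: "nat \<Rightarrow> nat \<Rightarrow> nat list set" where
  "decreasing_indices r N =
     {ns. length ns = r \<and> sorted_wrt (>) ns \<and> set ns \<subseteq> {1..N}}"

text \<open>The multiple series is the limit of its truncations to \<open>N \<ge> n\<^sub>1 > \<dots> > n\<^sub>r \<ge> 1\<close>;
  it need not converge absolutely (e.g. \<open>s\<^sub>1 = 1\<close>, \<open>z\<^sub>1 = -1\<close>). List positions start at 0, so
  \<open>s ! i\<close> and \<open>z ! i\<close> are the entries with index \<open>i + 1\<close>.\<close>

definition multi_polylog :: "nat list \<Rightarrow> 'a :: real_normed_field list \<Rightarrow> 'a" where
  "multi_polylog s z =
     lim (\<lambda>N. \<Sum>ns\<in>decreasing_indices (length s) N.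
                \<Prod>i<length s. (z ! i) ^ (ns ! i) / of_nat (ns ! i) ^ (s ! i))"

definition multi_polylog1 :: "nat list \<Rightarrow> 'a :: real_normed_field \<Rightarrow> 'a" where
  "multi_polylog1 s z = multi_polylog s (z # replicate (length s - 1) 1)"

text \<open>The families \<open>p\<close>, \<open>m\<close> and \<open>\<sigma>\<close> are indexed from 1: only \<open>p 1, \<dots>, p k\<close>,
  \<open>m 1, \<dots>, m (k + 1)\<close> and \<open>\<sigma> 1, \<dots>, \<sigma> P\<close> matter.\<close>

definition lhs_index :: "nat \<Rightarrow> (nat \<Rightarrow> nat) \<Rightarrow> (nat \<Rightarrow> nat) \<Rightarrow> nat list" where
  "lhs_index k p m =
     replicate (m 1) 1 @
     concat (map (\<lambda>i. (p i + 1) # replicate (m (i + 1) - 1) 1) [1..<k + 1])"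

definition tail_sum :: "nat \<Rightarrow> (nat \<Rightarrow> nat) \<Rightarrow> nat \<Rightarrow> nat" where
  "tail_sum k p i = (\<Sum>j = k + 1 - i..k. p j)"

definition eta :: "real \<Rightarrow> real \<Rightarrow> real" where
  "eta a x = (if x = 1 then 1 else - a)"

text \<open>If \<open>p (k + 1 - i) = 1\<close>, the middle part of the block is empty.\<close>

definition block :: "nat \<Rightarrow> (nat \<Rightarrow> nat) \<Rightarrow> real \<Rightarrow> (nat \<Rightarrow> real) \<Rightarrow> nat \<Rightarrow> real list" where
  "block k p a \<sigma> i =
     (if p (k + 1 - i) = 0 then [1]
      else [\<sigma> (tail_sum k p (i - 1) + 1) / a]
           @ map (\<lambda>j. \<sigma> (j + 1) / \<sigma> j) [tail_sum k p (i - 1) + 1..<tail_sum k p i]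
           @ [a / \<sigma> (tail_sum k p i)])"

definition zseq ::
  "nat \<Rightarrow> (nat \<Rightarrow> nat) \<Rightarrow> (nat \<Rightarrow> nat) \<Rightarrow> real \<Rightarrow> (nat \<Rightarrow> real) \<Rightarrow> real list" where
  "zseq k p m a \<sigma> =
     [a] @ replicate (m (k + 1) - 1) 1
     @ concat (map (\<lambda>i. block k p a \<sigma> i @ replicate (m (k + 1 - i) - 1) 1) [1..<k])
     @ (if m 1 = 0 then butlast (block k p a \<sigma> k)
        else block k p a \<sigma> k @ replicate (m 1 - 1) 1)"

end

theory Submission
  imports Defs
begin

text \<open>Both sides are iterated integrals from 0 to \<open>a\<close>. The left-hand side is the integral of a word in
  \<open>dt / t\<close> and \<open>dt / (1 - t)\<close>. The involution \<open>t \<mapsto> (a - t) / (1 - t)\<close> exchanges the end points,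
  reverses the word, fixes \<open>dt / (1 - t)\<close> and turns \<open>dt / t\<close> into \<open>dt / (a - t) - dt / (1 - t)\<close>.
  Expanding the differences gives the sum over \<open>\<sigma>\<close>. The integrals are handled as power series inside
  the disc of convergence, and Abel's theorem passes to its boundary.\<close>

text \<open>All dual letters have the shape \<open>c dx / (1 - c x)\<close> with \<open>c\<close>
  equal to 1 or \<open>a\<close>. Integrating two of them in succession multiplies coefficients by
  powers of the quotient of their labels \<open>c\<close>; hence all indices on the right are 1 and
  the arguments are ratios of neighbouring labels. A multiple series truncated at \<open>N\<close>
  is exactly a partial sum of power series coefficients, so the limit in
  \<open>multi_polylog\<close> is an ordered sum and needs no absolute convergence. The obstacle is
  the end point 1. The letter with \<open>c = 1\<close> is singular there, so partial integrals may
  diverge like powers of a logarithm. Two facts control this: all coefficients are O(1 / sqrt n),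
  which is enough to kill the boundary terms, and the outermost dual letter always has label
  \<open>a\<close>, because \<open>m (k + 1) \<ge> 1\<close>, so every series on the right
  converges.\<close>

unbundle no vec_syntax
unbundle fps_syntax

subsection \<open>Power series on the boundary of the unit disc\<close>

text \<open>A finite head of the series stays bounded and is killed by \<open>1 - x\<close>; the
  tail is at most \<open>e / 2\<close> times the geometric series \<open>1 / (1 - x)\<close>. This
  also tames series that diverge logarithmically at 1.\<close>

lemma one_minus_times_powser_tendsto_0:
  fixes t :: "nat \<Rightarrow> real"
  assumes "t \<longlonglongrightarrow> 0"
  shows "((\<lambda>x. (1 - x) * (\<Sum>n. t n * x ^ n)) \<longlongrightarrow> 0) (at_left 1)"
proof (rule tendstoI)
  fix e :: real assume e: "e > 0"
  obtain N where N: "\<And>n. n \<ge> N \<Longrightarrow> \<bar>t n\<bar> < e / 2"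
    using LIMSEQ_D[OF assms, of "e / 2"] e by auto
  define B where "B = (\<Sum>n<N. \<bar>t n\<bar>)"
  have B: "B \<ge> 0" by (simp add: B_def sum_nonneg)
  have bound: "\<bar>(1 - x) * (\<Sum>n. t n * x ^ n)\<bar> \<le> (1 - x) * B + e / 2" if x: "0 < x" "x < 1" for x
  proof -
    have s1: "(\<lambda>n. if n \<in> {..<N} then \<bar>t n\<bar> else 0) sums B"
      unfolding B_def by (rule sums_If_finite_set) auto
    have s2: "(\<lambda>n. e / 2 * x ^ n) sums (e / 2 * (1 / (1 - x)))"
      by (intro sums_mult geometric_sums) (use x in auto)
    have le: "norm (t n * x ^ n) \<le> (if n \<in> {..<N} then \<bar>t n\<bar> else 0) + e / 2 * x ^ n" for n
    proof (cases "n < N")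
      case True
      have "\<bar>t n\<bar> * x ^ n \<le> \<bar>t n\<bar> * 1"
        using x by (intro mult_left_mono power_le_one) auto
      moreover have "0 \<le> e / 2 * x ^ n" using x e by auto
      ultimately show ?thesis using True x by (simp add: abs_mult)
    next
      case False
      have "\<bar>t n\<bar> * x ^ n \<le> e / 2 * x ^ n"
        using N[of n] False x by (intro mult_right_mono) auto
      then show ?thesis using False x by (simp add: abs_mult)
    qed
    have "norm (\<Sum>n. t n * x ^ n) \<le> (\<Sum>n. (if n \<in> {..<N} then \<bar>t n\<bar> else 0) + e / 2 * x ^ n)"
      using le sums_summable[OF sums_add[OF s1 s2]] by (rule norm_suminf_le)
    also have "\<dots> = B + e / 2 * (1 / (1 - x))"
      using sums_unique[OF sums_add[OF s1 s2]] by simp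
    finally have "(1 - x) * \<bar>\<Sum>n. t n * x ^ n\<bar> \<le> (1 - x) * (B + e / 2 * (1 / (1 - x)))"
      using x by (intro mult_left_mono) auto
    also have "\<dots> = (1 - x) * B + e / 2" using x by (simp add: field_simps)
    finally show ?thesis using x by (simp add: abs_mult)
  qed
  have "((\<lambda>x. (1 - x) * B + e / 2) \<longlongrightarrow> (1 - 1) * B + e / 2) (at_left (1::real))"
    by (intro tendsto_intros)
  then have "\<forall>\<^sub>F x in at_left (1::real). (1 - x) * B + e / 2 < e"
    by (rule order_tendstoD(2)) (use e in simp)
  moreover have "\<forall>\<^sub>F x in at_left (1::real). x \<in> {0<..<1}"
    by (rule eventually_at_left_real) simp
  ultimately show "\<forall>\<^sub>F x in at_left 1. dist ((1 - x) * (\<Sum>n. t n * x ^ n)) 0 < e"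
  proof eventually_elim
    case (elim x)
    then show ?case using bound[of x] by simp
  qed
qed

lemma fps_conv_radius_bounded:
  fixes F :: "real fps"
  assumes "\<And>n. \<bar>F $ n\<bar> \<le> C"
  shows "fps_conv_radius F \<ge> 1"
  unfolding fps_conv_radius_def
proof (rule conv_radius_geI_ex')
  fix r :: real assume r: "0 < r" "ereal r < 1"
  show "summable (\<lambda>n. F $ n * of_real r ^ n)"
  proof (rule summable_comparison_test')
    show "summable (\<lambda>n. C * r ^ n)"
      using r by (intro summable_mult summable_geometric) auto
    show "norm (F $ n * of_real r ^ n) \<le> C * r ^ n" for n
      using assms[of n] r by (auto simp: abs_mult intro!: mult_right_mono)
  qed
qed

text \<open>Summation by parts: if \<open>T\<close> collects the partial sums minus the total
  \<open>S\<close>, then \<open>F = (1 - fps_X) * T + fps_const S\<close>, and the coefficients of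
  \<open>T\<close> tend to 0.\<close>

lemma abel_limit:
  fixes F :: "real fps"
  assumes "summable (fps_nth F)"
  shows "(eval_fps F \<longlongrightarrow> (\<Sum>n. F $ n)) (at_left 1)"
proof -
  define S where "S = (\<Sum>n. F $ n)"
  define T where "T = Abs_fps (\<lambda>n. (\<Sum>k\<le>n. F $ k) - S)"
  have T0: "(\<lambda>n. T $ n) \<longlonglongrightarrow> 0"
    unfolding T_def S_def using LIM_zero[OF summable_LIMSEQ'[OF assms]] by simp
  then obtain C where "\<And>n. \<bar>T $ n\<bar> \<le> C"
    using Bseq_def convergent_imp_Bseq[OF convergentI[OF T0]] by (metis real_norm_def)
  then have T1: "fps_conv_radius T \<ge> 1" by (rule fps_conv_radius_bounded)
  have F: "F = (1 - fps_X) * T + fps_const S"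
  proof (rule fps_ext)
    fix n show "F $ n = ((1 - fps_X) * T + fps_const S) $ n"
      by (cases n) (simp_all add: T_def algebra_simps)
  qed
  have eval: "eval_fps F x = (1 - x) * (\<Sum>n. T $ n * x ^ n) + S" if "0 < x" "x < 1" for x
  proof -
    have x: "norm x < fps_conv_radius T" using T1 that
      by (metis abs_of_pos ereal_less(3) less_le_trans real_norm_def)
    have r: "fps_conv_radius (1 - fps_X :: real fps) = \<infinity>"
      using fps_conv_radius_diff[of 1 "fps_X :: real fps"] by simp
    have "norm x < fps_conv_radius ((1 - fps_X) * T)"
      using fps_conv_radius_mult[of "1 - fps_X" T] x r by (simp add: less_le_trans)
    then have "eval_fps F x = eval_fps (1 - fps_X) x * eval_fps T x + S"
      unfolding F using x r by (simp add: eval_fps_add eval_fps_mult)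
    also have "eval_fps (1 - fps_X) x = 1 - x" by (subst eval_fps_diff) auto
    finally show ?thesis by (simp add: eval_fps_def)
  qed
  have "((\<lambda>x. (1 - x) * (\<Sum>n. T $ n * x ^ n) + S) \<longlongrightarrow> 0 + S) (at_left 1)"
    by (intro tendsto_add tendsto_const one_minus_times_powser_tendsto_0 T0)
  moreover have "\<forall>\<^sub>F x in at_left (1::real). x \<in> {0<..<1}"
    by (rule eventually_at_left_real) simp
  then have "\<forall>\<^sub>F x in at_left (1::real). (1 - x) * (\<Sum>n. T $ n * x ^ n) + S = eval_fps F x"
    by eventually_elim (simp add: eval)
  ultimately show ?thesis
    unfolding S_def[symmetric] using Lim_transform_eventually by fastforce
qed

subsection \<open>Coefficient bounds\<close>

text \<open>The coefficients that occur are at most a power of \<open>log n\<close> over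
  \<open>n\<close>. The weaker order 1 / sqrt n avoids logarithms, survives integration against
  kernels with bounded coefficients, and still makes \<open>F $ n / n\<close> absolutely summable;
  any exponent strictly between 0 and 1 would serve. The constant coefficient is left free.\<close>

definition sqrt_decay :: "real fps \<Rightarrow> bool" where
  "sqrt_decay F \<longleftrightarrow> (\<exists>C. \<forall>n. \<bar>F $ n\<bar> * sqrt (real n) \<le> C)"

lemma sqrt_decayE:
  assumes "sqrt_decay F"
  obtains C where "C \<ge> 0" "\<And>n. \<bar>F $ Suc n\<bar> \<le> C / sqrt (real (Suc n))"
proof -
  obtain C where C: "\<And>n. \<bar>F $ n\<bar> * sqrt (real n) \<le> C"
    using assms by (auto simp: sqrt_decay_def)
  have "C \<ge> 0" using C[of 0] by simp
  moreover have "\<bar>F $ Suc n\<bar> \<le> C / sqrt (real (Suc n))" for n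
    using C[of "Suc n"] by (simp add: field_simps)
  ultimately show ?thesis by (rule that)
qed

lemma sqrt_decay_tendsto_0:
  assumes "sqrt_decay F"
  shows "(\<lambda>n. F $ n) \<longlonglongrightarrow> 0"
proof -
  obtain C where C: "C \<ge> 0" "\<And>n. \<bar>F $ Suc n\<bar> \<le> C / sqrt (real (Suc n))"
    using sqrt_decayE[OF assms] by blast
  have "(\<lambda>n. C / sqrt (real n)) \<longlonglongrightarrow> 0"
    by (intro tendsto_divide_0[OF tendsto_const] filterlim_at_top_imp_at_infinity
        filterlim_compose[OF sqrt_at_top] filterlim_real_sequentially)
  then have "(\<lambda>n. C / sqrt (real (Suc n))) \<longlonglongrightarrow> 0"
    by (rule filterlim_compose[OF _ filterlim_Suc])
  then have "(\<lambda>n. F $ Suc n) \<longlonglongrightarrow> 0"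
    by (rule Lim_null_comparison[rotated]) (use C in auto)
  then show ?thesis by (simp only: filterlim_sequentially_Suc)
qed

lemma sqrt_decay_conv_radius:
  assumes "sqrt_decay F"
  shows "fps_conv_radius F \<ge> 1"
proof -
  obtain C where "\<And>n. \<bar>F $ n\<bar> \<le> C"
    using Bseq_def convergent_imp_Bseq[OF convergentI[OF sqrt_decay_tendsto_0[OF assms]]]
    by (metis real_norm_def)
  then show ?thesis by (rule fps_conv_radius_bounded)
qed

lemma sqrt_decay_summable:
  assumes "sqrt_decay F"
  shows "summable (\<lambda>n. \<bar>F $ Suc n\<bar> / real (Suc n))"
proof -
  obtain C where C: "C \<ge> 0" "\<And>n. \<bar>F $ Suc n\<bar> \<le> C / sqrt (real (Suc n))"
    using sqrt_decayE[OF assms] by blast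
  have "summable (\<lambda>n. real n powr (- 3 / 2))" by (simp add: summable_real_powr_iff)
  then have "summable (\<lambda>n. C * real (Suc n) powr (- 3 / 2))"
    by (intro summable_mult) (subst summable_Suc_iff[where f = "\<lambda>n. real n powr (- 3 / 2)"])
  then show ?thesis
  proof (rule summable_comparison_test')
    fix n
    have "real (Suc n) powr (- 3 / 2) = real (Suc n) powr (- (1 / 2) - 1)" by simp
    also have "\<dots> = 1 / sqrt (real (Suc n)) / real (Suc n)"
      by (simp only: powr_diff powr_minus powr_half_sqrt of_nat_0_le_iff) (simp add: field_simps)
    finally have "C * real (Suc n) powr (- 3 / 2) = C / sqrt (real (Suc n)) / real (Suc n)"
      by simp
    then show "norm (\<bar>F $ Suc n\<bar> / real (Suc n)) \<le> C * real (Suc n) powr (- 3 / 2)"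
      using divide_right_mono[OF C(2)[of n], of "real (Suc n)"] by simp
  qed
qed

lemma sqrt_decay_1: "sqrt_decay 1"
  unfolding sqrt_decay_def by (intro exI[of _ 0]) (auto simp: fps_one_nth)

lemma sqrt_decay_integral_shift:
  assumes "sqrt_decay F"
  shows "sqrt_decay (fps_integral0 (fps_shift 1 F))"
proof -
  obtain C where C: "C \<ge> 0" "\<And>n. \<bar>F $ Suc n\<bar> \<le> C / sqrt (real (Suc n))"
    using sqrt_decayE[OF assms] by blast
  have "\<bar>fps_integral0 (fps_shift 1 F) $ n\<bar> * sqrt (real n) \<le> C" for n
  proof (cases n)
    case (Suc m)
    have "\<bar>F $ Suc m\<bar> / real (Suc m) \<le> \<bar>F $ Suc m\<bar> / 1"
      by (intro divide_left_mono) auto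
    then have "\<bar>F $ Suc m\<bar> / real (Suc m) \<le> C / sqrt (real (Suc m))"
      using C(2)[of m] by linarith
    then show ?thesis using Suc by (simp add: field_simps abs_mult)
  qed (use C in auto)
  then show ?thesis unfolding sqrt_decay_def by blast
qed

text \<open>A bounded kernel replaces coefficients by at most sums of \<open>1 / sqrt j\<close>,
  which grow like \<open>sqrt m\<close>; integration then divides by \<open>m + 1\<close>.\<close>

lemma sqrt_decay_integral_mult:
  assumes F: "sqrt_decay F" and h: "\<And>n. \<bar>h $ n\<bar> \<le> H"
  shows "sqrt_decay (fps_integral0 (h * F))"
proof -
  obtain C where C: "C \<ge> 0" "\<And>n. \<bar>F $ Suc n\<bar> \<le> C / sqrt (real (Suc n))"
    using sqrt_decayE[OF F] by blast
  define K where "K = \<bar>F $ 0\<bar> + 3 * C"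
  have H: "H \<ge> 0" using h[of 0] by simp
  have sums: "(\<Sum>j\<le>m. \<bar>F $ j\<bar>) \<le> K * sqrt (real (Suc m))" for m
  proof (induction m)
    case 0
    then show ?case using C by (simp add: K_def)
  next
    case (Suc m)
    \<comment> \<open>The new summand is at most \<open>C / s\<close>. From
      \<open>(t + s) * (t - s) = 1\<close> and \<open>t + s \<le> 3 * s\<close> it is at most
      \<open>3 * C * (t - s)\<close>, which telescopes; this is the 3 in \<open>K\<close>, whose
      other term serves the base case.\<close>
    define s t where "s = sqrt (real (Suc m))" and "t = sqrt (real (Suc (Suc m)))"
    have s: "s \<ge> 1" and t: "s \<le> t" by (simp_all add: s_def t_def)
    have "t \<le> sqrt (4 * real (Suc m))" unfolding t_def by (rule real_sqrt_le_mono) simp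
    also have "\<dots> = 2 * s" unfolding s_def by (subst real_sqrt_mult) simp
    finally have "t \<le> 2 * s" .
    then have "(t + s) * (t - s) \<le> (3 * s) * (t - s)"
      using t by (intro mult_right_mono) auto
    moreover have "(t + s) * (t - s) = t\<^sup>2 - s\<^sup>2" by (simp add: power2_eq_square algebra_simps)
    moreover have "t\<^sup>2 - s\<^sup>2 = 1" by (simp add: s_def t_def)
    ultimately have "1 / s \<le> 3 * (t - s)" using s by (simp add: field_simps)
    then have "C * (1 / s) \<le> C * (3 * (t - s))" using C by (intro mult_left_mono) auto
    also have "\<dots> \<le> K * (t - s)" using t C unfolding K_def mult.assoc[symmetric] mult.commute[of C]
      by (intro mult_right_mono) auto
    finally have "\<bar>F $ Suc m\<bar> \<le> K * (t - s)" using C(2)[of m] by (simp add: s_def)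
    then show ?case using Suc by (simp add: s_def t_def algebra_simps)
  qed
  have "\<bar>fps_integral0 (h * F) $ n\<bar> * sqrt (real n) \<le> H * K" for n
  proof (cases n)
    case 0
    then show ?thesis using H C by (simp add: K_def)
  next
    case (Suc m)
    have "\<bar>(h * F) $ m\<bar> \<le> (\<Sum>i=0..m. \<bar>h $ i * F $ (m - i)\<bar>)"
      unfolding fps_mult_nth by (rule sum_abs)
    also have "\<dots> \<le> (\<Sum>i=0..m. H * \<bar>F $ (m - i)\<bar>)"
      using h by (intro sum_mono) (simp add: abs_mult mult_right_mono)
    also have "\<dots> = H * (\<Sum>j\<le>m. \<bar>F $ j\<bar>)"
      unfolding sum_distrib_left[symmetric] atLeast0AtMost
      using sum.nat_diff_reindex[of "\<lambda>j. \<bar>F $ j\<bar>" "Suc m"] by (simp add: lessThan_Suc_atMost)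
    also have "\<dots> \<le> H * (K * sqrt (real (Suc m)))"
      using sums H by (intro mult_left_mono)
    finally have "\<bar>(h * F) $ m\<bar> * sqrt (real (Suc m)) \<le> H * K * sqrt (real (Suc m)) * sqrt (real (Suc m))"
      by (intro mult_right_mono) (simp_all add: mult.assoc)
    then have "\<bar>(h * F) $ m\<bar> * sqrt (real (Suc m)) \<le> H * K * real (Suc m)"
      by (simp add: mult.assoc)
    then show ?thesis using Suc by (simp add: abs_mult field_simps)
  qed
  then show ?thesis unfolding sqrt_decay_def by blast
qed

lemma summable_integral_shift:
  assumes "sqrt_decay F"
  shows "summable (\<lambda>n. fps_integral0 (fps_shift 1 F) $ n)"
proof -
  have "summable (\<lambda>n. \<bar>fps_integral0 (fps_shift 1 F) $ Suc n\<bar>)"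
    using sqrt_decay_summable[OF assms] by (simp add: abs_mult divide_inverse mult.commute)
  then have "summable (\<lambda>n. fps_integral0 (fps_shift 1 F) $ Suc n)"
    by (rule summable_rabs_cancel)
  then show ?thesis by (subst (asm) summable_Suc_iff)
qed

text \<open>The expansion of \<open>c / (1 - c * x)\<close>; the exponent \<open>Suc n\<close>
  accounts for the numerator.\<close>

definition geo_fps :: "real \<Rightarrow> real fps" where
  "geo_fps c = Abs_fps (\<lambda>n. c ^ Suc n)"

lemma geo_fps_nth [simp]: "geo_fps c $ n = c ^ Suc n"
  by (simp add: geo_fps_def)

lemma geo_fps_bound: "\<bar>c\<bar> \<le> 1 \<Longrightarrow> \<bar>geo_fps c $ n\<bar> \<le> 1"
  by (simp add: power_abs power_le_one del: power_Suc)

text \<open>The coefficients satisfy \<open>g (n + 1) = a * g n + r n\<close> with \<open>r\<close> absolutely summable. As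
  \<open>a \<noteq> 1\<close>, this makes \<open>g\<close> a combination of \<open>r\<close> and a telescoping term; \<open>a = - 1\<close> needs no
  special treatment although the series then converges only conditionally.\<close>

lemma summable_integral_geo:
  assumes F: "sqrt_decay F" and a: "\<bar>a\<bar> \<le> 1" "a \<noteq> 1"
  shows "summable (\<lambda>n. fps_integral0 (geo_fps a * F) $ n)"
proof -
  define G where "G = fps_integral0 (geo_fps a * F)"
  have G: "sqrt_decay G" unfolding G_def
    by (rule sqrt_decay_integral_mult[OF F geo_fps_bound[OF a(1)]])
  define g where "g n = G $ Suc n" for n
  \<comment> \<open>The recurrence is
    \<open>(n + 2) * g (n + 1) = a * ((n + 1) * g n + F $ (n + 1))\<close>. Writing
    \<open>(n + 1) / (n + 2)\<close> as \<open>1 - 1 / (n + 2)\<close> leaves this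
    remainder.\<close>
  define r where "r n = a * (F $ Suc n / real (n + 2)) - a * (g n / real (n + 2))" for n
  have e: "(geo_fps a * F) $ Suc n = a * (geo_fps a * F) $ n + a * F $ Suc n" for n
  proof -
    \<comment> \<open>Clearing the denominator of the geometric kernel turns the convolution into a
      first-order recurrence.\<close>
    have "(1 - fps_const a * fps_X) * geo_fps a = fps_const a"
    proof (rule fps_ext)
      fix n show "((1 - fps_const a * fps_X) * geo_fps a) $ n = fps_const a $ n"
        by (cases n) (simp_all add: algebra_simps)
    qed
    then have "(1 - fps_const a * fps_X) * (geo_fps a * F) = fps_const a * F"
      by (metis mult.assoc)
    then have "((1 - fps_const a * fps_X) * (geo_fps a * F)) $ Suc n = (fps_const a * F) $ Suc n"
      by (rule arg_cong)
    moreover have "(1 - fps_const a * fps_X) * (geo_fps a * F) = geo_fps a * F - fps_const a * (fps_X * (geo_fps a * F))"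
      by (simp add: algebra_simps)
    moreover have "(geo_fps a * F - fps_const a * (fps_X * (geo_fps a * F))) $ Suc n
      = (geo_fps a * F) $ Suc n - a * (geo_fps a * F) $ n"
      by (simp only: fps_sub_nth fps_mult_left_const_nth fps_X_mult_nth) simp
    ultimately show ?thesis by (simp add: fps_mult_left_const_nth)
  qed
  have g: "g (Suc n) = a * g n + r n" for n
  proof -
    have "(geo_fps a * F) $ n = real (Suc n) * g n"
      by (simp add: g_def G_def)
    then have "real (n + 2) * g (Suc n) = a * (real (Suc n) * g n) + a * F $ Suc n"
      using e[of n] by (simp add: g_def G_def field_simps)
    then show ?thesis
      by (simp add: r_def divide_simps) (simp add: algebra_simps)
  qed
  have summ: "summable (\<lambda>n. K $ Suc n / real (n + 2))" if "sqrt_decay K" for K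
    by (rule summable_comparison_test'[OF sqrt_decay_summable[OF that]])
      (auto simp: intro!: divide_left_mono)
  have r: "summable r"
    unfolding r_def g_def by (intro summable_diff summable_mult summ F G)
  have "g \<longlonglongrightarrow> 0"
    unfolding g_def by (rule filterlim_compose[OF sqrt_decay_tendsto_0[OF G] filterlim_Suc])
  then have "summable (\<lambda>n. g (Suc n) - g n)" by (rule telescope_summable)
  with r have "summable (\<lambda>n. (r n - (g (Suc n) - g n)) / (1 - a))"
    by (intro summable_divide summable_diff[of r])
  also have "(\<lambda>n. (r n - (g (Suc n) - g n)) / (1 - a)) = g"
    using a by (simp add: g field_simps fun_eq_iff)
  finally show ?thesis unfolding g_def G_def by (subst (asm) summable_Suc_iff)
qed

subsection \<open>Reversal of the path of integration\<close>

text \<open>Integrals along the segment from 0 to \<open>a\<close> are rescaled to the unit interval: \<open>X0\<close> is the form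
  \<open>dx / x\<close> and \<open>X1\<close> is \<open>a dx / (1 - a x)\<close>. The head of a word is the outermost form.\<close>

datatype form = X0 | X1

text \<open>Division by \<open>x\<close> is \<open>fps_shift 1\<close>, which discards the constant
  coefficient. It is a true division unless the remaining word is empty: \<open>[X0]\<close> yields
  0 instead of a logarithm.\<close>

fun polylog_fps :: "real \<Rightarrow> form list \<Rightarrow> real fps" where
  "polylog_fps a [] = 1"
| "polylog_fps a (X0 # w) = fps_integral0 (fps_shift 1 (polylog_fps a w))"
| "polylog_fps a (X1 # w) = fps_integral0 (geo_fps a * polylog_fps a w)"

text \<open>Letters are arbitrary power series, so that one notion covers both the dual integral,
  with a difference as a letter, and the summands of its expansion.\<close>

fun iter_fps :: "real fps list \<Rightarrow> real fps" where
  "iter_fps [] = 1"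
| "iter_fps (h # hs) = fps_integral0 (h * iter_fps hs)"

text \<open>Up to sign, these are the pullbacks of the two forms along the involution
  \<open>x \<mapsto> (1 - x) / (1 - a x)\<close>, which exchanges the end points 0 and 1.\<close>

fun dual_form :: "real \<Rightarrow> form \<Rightarrow> real fps" where
  "dual_form a X0 = geo_fps 1 - geo_fps a"
| "dual_form a X1 = geo_fps a"

abbreviation dual_fps :: "real \<Rightarrow> form list \<Rightarrow> real fps" where
  "dual_fps a w \<equiv> iter_fps (map (dual_form a) w)"

section \<open>Growth of coefficients and convergence at 1\<close>

lemma sqrt_decay_polylog_fps: "\<bar>a\<bar> \<le> 1 \<Longrightarrow> sqrt_decay (polylog_fps a w)"
  by (induction a w rule: polylog_fps.induct)
    (auto intro!: sqrt_decay_1 sqrt_decay_integral_shift[simplified]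
      intro: sqrt_decay_integral_mult[OF _ geo_fps_bound])

lemma sqrt_decay_iter_fps:
  assumes "\<And>h n. h \<in> set hs \<Longrightarrow> \<bar>h $ n\<bar> \<le> H"
  shows "sqrt_decay (iter_fps hs)"
  using assms by (induction hs) (auto intro!: sqrt_decay_1 sqrt_decay_integral_mult[of _ _ H])

lemma dual_form_bound:
  assumes "\<bar>a\<bar> \<le> 1"
  shows "\<bar>dual_form a c $ n\<bar> \<le> 2"
proof (cases c)
  case X0
  have "\<bar>1 - a ^ Suc n\<bar> \<le> 1 + \<bar>a ^ Suc n\<bar>" by linarith
  also have "\<dots> \<le> 2" using geo_fps_bound[OF assms, of n] by simp
  finally show ?thesis by (simp add: X0)
next
  case X1
  show ?thesis using geo_fps_bound[OF assms, of n] by (simp add: X1)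
qed

lemma sqrt_decay_dual_fps: "\<bar>a\<bar> \<le> 1 \<Longrightarrow> sqrt_decay (dual_fps a w)"
  by (rule sqrt_decay_iter_fps[of _ 2]) (use dual_form_bound in auto)

text \<open>Only the outermost letter matters: \<open>X0\<close> divides coefficient
  \<open>n\<close> by \<open>n\<close>, which gives absolute convergence, and \<open>X1\<close> is
  regular at 1 because \<open>a \<noteq> 1\<close>.\<close>

lemma summable_polylog_fps:
  assumes "\<bar>a\<bar> \<le> 1" "a \<noteq> 1"
  shows "summable (\<lambda>n. polylog_fps a w $ n)"
proof (cases w)
  case Nil
  then show ?thesis
    using summable_finite[of "{0}" "fps_nth (1 :: real fps)"] by simp
next
  case (Cons c v)
  then show ?thesis
    using assms sqrt_decay_polylog_fps[of a v]
    by (cases c) (simp_all add: summable_integral_shift[simplified] summable_integral_geo)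
qed

section \<open>Evaluation and derivatives inside the disc\<close>

lemma norm_less_conv_radius:
  assumes "fps_conv_radius F \<ge> 1" "\<bar>x\<bar> < 1"
  shows "norm (x :: real) < fps_conv_radius F"
proof -
  have "ereal (norm x) < 1" using assms(2) by simp
  then show ?thesis using assms(1) by (rule less_le_trans)
qed

lemma geo_fps_conv_radius: "\<bar>c\<bar> \<le> 1 \<Longrightarrow> fps_conv_radius (geo_fps c) \<ge> 1"
  by (rule fps_conv_radius_bounded[of _ 1]) (use geo_fps_bound in blast)

lemma eval_geo_fps:
  assumes "\<bar>c\<bar> \<le> 1" "\<bar>x\<bar> < 1"
  shows "eval_fps (geo_fps c) x = c / (1 - c * x)"
proof -
  have "\<bar>c * x\<bar> \<le> 1 * \<bar>x\<bar>" unfolding abs_mult using assms by (intro mult_right_mono) auto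
  then have "\<bar>c * x\<bar> < 1" using assms by linarith
  then have "(\<lambda>n. c * (c * x) ^ n) sums (c * (1 / (1 - c * x)))"
    by (intro sums_mult geometric_sums) auto
  then show ?thesis
    unfolding eval_fps_def
    by (intro sums_unique[symmetric]) (simp add: power_mult_distrib mult.assoc)
qed

lemma eval_dual_form:
  assumes "\<bar>a\<bar> \<le> 1" "\<bar>x\<bar> < 1"
  shows "eval_fps (dual_form a c) x = (case c of X0 \<Rightarrow> 1 / (1 - x) - a / (1 - a * x) | X1 \<Rightarrow> a / (1 - a * x))"
  using assms norm_less_conv_radius[OF geo_fps_conv_radius, of _ x]
  by (cases c) (simp_all add: eval_fps_diff eval_geo_fps)

lemma has_derivative_integral:
  fixes x :: real
  assumes "fps_conv_radius (fps_integral0 F) \<ge> 1" "\<bar>x\<bar> < 1"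
  shows "(eval_fps (fps_integral0 F) has_field_derivative eval_fps F x) (at x)"
  using has_field_derivative_eval_fps[OF norm_less_conv_radius[OF assms], of UNIV]
  by (simp add: fps_deriv_fps_integral)

lemma has_derivative_dual_fps:
  assumes a: "\<bar>a\<bar> \<le> 1" and x: "\<bar>x\<bar> < 1"
  shows "(eval_fps (dual_fps a (c # w)) has_field_derivative
           eval_fps (dual_form a c) x * eval_fps (dual_fps a w) x) (at x)"
proof -
  have "eval_fps (dual_form a c * dual_fps a w) x
      = eval_fps (dual_form a c) x * eval_fps (dual_fps a w) x"
    by (intro eval_fps_mult norm_less_conv_radius x sqrt_decay_conv_radius sqrt_decay_dual_fps a
        fps_conv_radius_bounded[of _ 2] dual_form_bound)
  then show ?thesis
    using has_derivative_integral[OF _ x, of "dual_form a c * dual_fps a w"]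
      sqrt_decay_conv_radius[OF sqrt_decay_dual_fps[OF a, of "c # w"]] by simp
qed

lemma polylog_fps_nth_0: "w \<noteq> [] \<Longrightarrow> polylog_fps a w $ 0 = 0"
  by (cases "(a, w)" rule: polylog_fps.cases) auto

lemma dual_fps_nth_0: "w \<noteq> [] \<Longrightarrow> dual_fps a w $ 0 = 0"
  by (cases w) auto

lemma eval_fps_shift_1:
  fixes F :: "real fps"
  assumes "fps_conv_radius F \<ge> 1" "\<bar>x\<bar> < 1" "F $ 0 = 0"
  shows "eval_fps F x = x * eval_fps (fps_shift 1 F) x"
proof -
  have "F = fps_X * fps_shift 1 F"
  proof (rule fps_ext)
    fix n show "F $ n = (fps_X * fps_shift 1 F) $ n"
      using assms(3) by (cases n) auto
  qed
  then have "eval_fps F x = eval_fps (fps_X * fps_shift 1 F) x" by simp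
  also have "\<dots> = x * eval_fps (fps_shift 1 F) x"
    by (subst eval_fps_mult) (auto intro!: norm_less_conv_radius[simplified] assms)
  finally show ?thesis .
qed

text \<open>The condition on \<open>c\<close> excludes the word \<open>[X0]\<close>, for which the
  shift discards the constant 1 and no \<open>1 / x\<close> appears.\<close>

lemma has_derivative_polylog_fps:
  assumes a: "\<bar>a\<bar> \<le> 1" and x: "0 < x" "x < 1" and c: "c = X0 \<Longrightarrow> w \<noteq> []"
  shows "(eval_fps (polylog_fps a (c # w)) has_field_derivative
           (case c of X0 \<Rightarrow> 1 / x | X1 \<Rightarrow> a / (1 - a * x)) * eval_fps (polylog_fps a w) x) (at x)"
proof -
  have x': "\<bar>x\<bar> < 1" using x by simp
  note cr = sqrt_decay_conv_radius[OF sqrt_decay_polylog_fps[OF a]]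
  show ?thesis
  proof (cases c)
    case X0
    have "eval_fps (fps_shift 1 (polylog_fps a w)) x = 1 / x * eval_fps (polylog_fps a w) x"
      using eval_fps_shift_1[OF cr x' polylog_fps_nth_0[OF c[OF X0]]] x by simp
    then show ?thesis
      using has_derivative_integral[OF _ x', of "fps_shift 1 (polylog_fps a w)"] cr[of "X0 # w"]
      by (simp add: X0)
  next
    case X1
    have "eval_fps (geo_fps a * polylog_fps a w) x = a / (1 - a * x) * eval_fps (polylog_fps a w) x"
      by (subst eval_fps_mult)
        (auto intro!: norm_less_conv_radius[simplified] x' geo_fps_conv_radius a cr simp: eval_geo_fps a x')
    then show ?thesis
      using has_derivative_integral[OF _ x', of "geo_fps a * polylog_fps a w"] cr[of "X1 # w"]
      by (simp add: X1)
  qed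
qed

text \<open>The sum over all splittings \<open>w = u @ v\<close> of the dual integral of \<open>rev u\<close> at
  \<open>(1 - x) / (1 - a x)\<close> times the integral of \<open>v\<close> at \<open>x\<close> has a telescoping derivative, so it is
  constant. Only \<open>u = w\<close> survives as \<open>x\<close> tends to 0, and only \<open>v = w\<close> as \<open>x\<close> tends to 1.\<close>

theorem suminf_polylog_fps_eq_dual:
  assumes a: "-1 \<le> a" "a < 1" and w: "w \<noteq> []" "last w = X1"
  shows "(\<Sum>n. polylog_fps a w $ n) = (\<Sum>n. dual_fps a (rev w) $ n)"
proof -
  have a1: "\<bar>a\<bar> \<le> 1" using a by simp
  define n where "n = length w"
  define \<psi> where "\<psi> = (\<lambda>x. (1 - x) / (1 - a * x))"
  define \<omega> where "\<omega> c x = (case c of X0 \<Rightarrow> 1 / x | X1 \<Rightarrow> a / (1 - a * x))" for c and x :: real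
  define A where "A i x = eval_fps (dual_fps a (rev (take i w))) (\<psi> x)" for i x
  define B where "B i x = eval_fps (polylog_fps a (drop i w)) x" for i x
  define \<Phi> where "\<Phi> x = (\<Sum>i\<le>n. A i x * B i x)" for x
  have ax: "1 - x < 1 - a * x" "a * x < 1" if "0 < x" "x < 1" for x
  proof -
    have "a * x < 1 * x" using that a by (intro mult_strict_right_mono) auto
    then show "1 - x < 1 - a * x" "a * x < 1" using that by linarith+
  qed
  have psi: "0 < \<psi> x" "\<psi> x < 1" if "0 < x" "x < 1" for x
    using ax[OF that] that by (auto simp: \<psi>_def field_simps)

  have derivA: "(A (Suc i) has_field_derivative - \<omega> (w ! i) x * A i x) (at x)"
    if i: "i < n" and x: "0 < x" "x < 1" for i x
  proof -
    have dpsi: "(\<psi> has_field_derivative - (1 - a) / (1 - a * x)\<^sup>2) (at x)"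
      unfolding \<psi>_def using ax[OF x]
      by (auto intro!: derivative_eq_intros simp: power2_eq_square field_simps)
    have rev_take: "rev (take (Suc i) w) = w ! i # rev (take i w)"
      using i by (simp add: n_def take_Suc_conv_app_nth)
    have lt: "\<bar>\<psi> x\<bar> < 1" using psi[OF x] by simp
    have "(A (Suc i) has_field_derivative
        (eval_fps (dual_form a (w ! i)) (\<psi> x) * A i x) * (- (1 - a) / (1 - a * x)\<^sup>2)) (at x)"
      unfolding A_def rev_take by (rule DERIV_chain2[OF has_derivative_dual_fps[OF a1 lt] dpsi])
    moreover have "eval_fps (dual_form a (w ! i)) (\<psi> x) * (- (1 - a) / (1 - a * x)\<^sup>2) = - \<omega> (w ! i) x"
    proof -
      have d: "1 - a * x \<noteq> 0" "1 - a \<noteq> 0" "x \<noteq> 0" using ax[OF x] a x by auto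
      \<comment> \<open>Both values contain \<open>(1 - a) / (1 - a * x)\<close>, which cancels
        against the derivative of \<open>\<psi>\<close>.\<close>
      have 1: "1 - \<psi> x = (1 - a) * x / (1 - a * x)" "1 - a * \<psi> x = (1 - a) / (1 - a * x)"
        using d by (simp_all add: \<psi>_def field_simps)
      show ?thesis
        unfolding eval_dual_form[OF a1 lt] \<omega>_def 1 using d
        by (cases "w ! i"; simp add: divide_simps power2_eq_square; simp add: algebra_simps)
    qed
    ultimately show ?thesis by (metis mult.assoc mult.commute)
  qed

  have derivB: "(B i has_field_derivative \<omega> (w ! i) x * B (Suc i) x) (at x)"
    if i: "i < n" and x: "0 < x" "x < 1" for i x
  proof -
    have "drop i w = w ! i # drop (Suc i) w" using i by (simp add: n_def Cons_nth_drop_Suc)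
    \<comment> \<open>Only the last letter leaves an empty rest, and it is \<open>X1\<close>, so the
      exceptional word \<open>[X0]\<close> never occurs.\<close>
    moreover have "drop (Suc i) w \<noteq> []" if "w ! i = X0"
    proof
      assume "drop (Suc i) w = []"
      then have "i = n - 1" using i by (simp add: n_def)
      then show False using that w by (simp add: n_def last_conv_nth)
    qed
    ultimately show ?thesis
      unfolding B_def \<omega>_def using has_derivative_polylog_fps[OF a1 x] by simp
  qed

  have deriv: "(\<Phi> has_field_derivative 0) (at x)" if x: "0 < x" "x < 1" for x
  proof -
    \<comment> \<open>The term of \<open>A'\<close> at \<open>Suc j\<close> cancels the term of
      \<open>B'\<close> at \<open>j\<close>. The leftover ends vanish because the factors of the
      empty prefix and of the empty suffix are constant.\<close>
    define A' where "A' i = (case i of 0 \<Rightarrow> 0 | Suc j \<Rightarrow> - \<omega> (w ! j) x * A j x)" for i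
    define B' where "B' i = (if i < n then \<omega> (w ! i) x * B (Suc i) x else 0)" for i
    have "(A i has_field_derivative A' i) (at x)" if "i \<le> n" for i
    proof (cases i)
      case 0
      have "A 0 = (\<lambda>_. 1)" by (simp add: A_def fun_eq_iff)
      then show ?thesis by (simp add: 0 A'_def)
    next
      case (Suc j)
      then show ?thesis using derivA[OF _ x, of j] that by (simp add: A'_def)
    qed
    moreover have "(B i has_field_derivative B' i) (at x)" if "i \<le> n" for i
    proof (cases "i < n")
      case True
      then show ?thesis using derivB[OF _ x, of i] by (simp add: B'_def)
    next
      case False
      then have "B i = (\<lambda>_. 1)" using that by (simp add: B_def fun_eq_iff n_def)
      then show ?thesis using False by (simp add: B'_def)
    qed
    ultimately have "(\<Phi> has_field_derivative (\<Sum>i\<le>n. A' i * B i x + B' i * A i x)) (at x)"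
      unfolding \<Phi>_def by (intro DERIV_sum DERIV_mult) auto
    also have "(\<Sum>i\<le>n. A' i * B i x + B' i * A i x) = (\<Sum>i\<le>n. A' i * B i x) + (\<Sum>i\<le>n. B' i * A i x)"
      by (rule sum.distrib)
    also have "(\<Sum>i\<le>n. A' i * B i x) = (\<Sum>i<n. A' (Suc i) * B (Suc i) x)"
      by (simp add: sum.atMost_shift A'_def)
    also have "(\<Sum>i\<le>n. B' i * A i x) = (\<Sum>i<n. B' i * A i x)"
      by (simp add: lessThan_Suc_atMost[symmetric] B'_def)
    also have "(\<Sum>i<n. A' (Suc i) * B (Suc i) x) + (\<Sum>i<n. B' i * A i x) = 0"
      unfolding sum.distrib[symmetric] by (intro sum.neutral) (simp add: A'_def B'_def)
    finally show ?thesis .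
  qed
  have const: "\<Phi> x = \<Phi> (1 / 2)" if "x \<in> {0<..<1}" for x
    by (rule DERIV_isconst3[of 0 1]) (use that deriv in auto)

  have psi_0: "filterlim \<psi> (at_left 1) (at_right 0)"
  proof -
    have "(\<psi> \<longlongrightarrow> (1 - 0) / (1 - a * 0)) (at_right 0)"
      unfolding \<psi>_def by (intro tendsto_intros) auto
    moreover have "\<forall>\<^sub>F x in at_right 0. x \<in> {0<..<1::real}"
      by (rule eventually_at_right_real) simp
    then have "\<forall>\<^sub>F x in at_right 0. \<psi> x < 1"
      by eventually_elim (use psi in auto)
    ultimately show ?thesis
      by (auto simp: filterlim_at elim!: eventually_mono)
  qed
  have psi_1: "(\<psi> \<longlongrightarrow> 0) (at_left 1)"
  proof -
    have "(\<psi> \<longlongrightarrow> (1 - 1) / (1 - a * 1)) (at_left 1)"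
      unfolding \<psi>_def by (intro tendsto_intros) (use a in auto)
    then show ?thesis by simp
  qed
  note crA = sqrt_decay_conv_radius[OF sqrt_decay_dual_fps[OF a1]]
  note crB = sqrt_decay_conv_radius[OF sqrt_decay_polylog_fps[OF a1]]

  \<comment> \<open>Every suffix has a finite Abel limit here, while the dual series of a nonempty
    prefix is evaluated near 0, where it vanishes.\<close>
  have "(\<Phi> \<longlongrightarrow> (\<Sum>i\<le>n. if i = 0 then \<Sum>n. polylog_fps a w $ n else 0)) (at_left 1)"
    unfolding \<Phi>_def
  proof (rule tendsto_sum)
    fix i assume "i \<in> {..n}"
    define F where "F = dual_fps a (rev (take i w))"
    have "isCont (eval_fps F) 0"
      unfolding F_def by (rule continuous_eval_fps, rule norm_less_conv_radius[OF crA]) simp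
    then have "(A i \<longlongrightarrow> eval_fps F 0) (at_left 1)"
      unfolding A_def F_def by (rule isCont_tendsto_compose[OF _ psi_1])
    moreover have "(B i \<longlongrightarrow> (\<Sum>n. polylog_fps a (drop i w) $ n)) (at_left 1)"
      unfolding B_def by (intro abel_limit summable_polylog_fps a1) (use a in auto)
    ultimately have "((\<lambda>x. A i x * B i x) \<longlongrightarrow> eval_fps F 0 * (\<Sum>n. polylog_fps a (drop i w) $ n))
        (at_left 1)"
      by (rule tendsto_mult)
    also have "eval_fps F 0 * (\<Sum>n. polylog_fps a (drop i w) $ n)
        = (if i = 0 then \<Sum>n. polylog_fps a w $ n else 0)"
    proof (cases "i = 0")
      case False
      then have "F $ 0 = 0" unfolding F_def using w by (intro dual_fps_nth_0) auto
      then show ?thesis using False by (simp add: eval_fps_at_0)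
    qed (simp add: F_def)
    finally show "((\<lambda>x. A i x * B i x) \<longlongrightarrow>
        (if i = 0 then \<Sum>n. polylog_fps a w $ n else 0)) (at_left 1)" .
  qed
  then have lim1: "(\<Phi> \<longlongrightarrow> (\<Sum>n. polylog_fps a w $ n)) (at_left 1)"
    by simp

  have "(\<Phi> \<longlongrightarrow> (\<Sum>i\<le>n. if i = n then \<Sum>n. dual_fps a (rev w) $ n else 0)) (at_right 0)"
    unfolding \<Phi>_def
  proof (rule tendsto_sum)
    fix i assume i: "i \<in> {..n}"
    show "((\<lambda>x. A i x * B i x) \<longlongrightarrow>
        (if i = n then \<Sum>n. dual_fps a (rev w) $ n else 0)) (at_right 0)"
    proof (cases "i = n")
      case True
      \<comment> \<open>The outermost dual letter comes from the last letter of \<open>w\<close> and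
        is regular at 1, so the dual series converges there.\<close>
      obtain v where v: "rev w = X1 # v"
        using w by (metis append_butlast_last_id rev_eq_Cons_iff rev_rev_ident)
      have "summable (\<lambda>n. dual_fps a (rev w) $ n)"
        using summable_integral_geo[OF sqrt_decay_dual_fps[OF a1, of v] a1] a by (simp add: v)
      then have "(eval_fps (dual_fps a (rev w)) \<longlongrightarrow> (\<Sum>n. dual_fps a (rev w) $ n)) (at_left 1)"
        by (rule abel_limit)
      then have "((\<lambda>x. eval_fps (dual_fps a (rev w)) (\<psi> x)) \<longlongrightarrow> (\<Sum>n. dual_fps a (rev w) $ n))
          (at_right 0)"
        using psi_0 by (rule filterlim_compose)
      then show ?thesis using True by (simp add: A_def B_def n_def)
    next
      case False
      \<comment> \<open>\<open>F\<close> may diverge at 1, so the two factors have no separate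
        limits. The nonempty suffix contributes a factor \<open>x\<close>, which equals
        \<open>(1 - \<psi> x) * (1 - a * x) / (1 - a)\<close>; its part \<open>1 - \<psi> x\<close>
        is spent on \<open>F\<close>.\<close>
      define F where "F = dual_fps a (rev (take i w))"
      define G where "G = polylog_fps a (drop i w)"
      have "((\<lambda>s. (1 - s) * eval_fps F s) \<longlongrightarrow> 0) (at_left 1)"
        unfolding eval_fps_def F_def
        by (intro one_minus_times_powser_tendsto_0 sqrt_decay_tendsto_0 sqrt_decay_dual_fps a1)
      then have "((\<lambda>x. (1 - \<psi> x) * eval_fps F (\<psi> x)) \<longlongrightarrow> 0) (at_right 0)"
        using psi_0 by (rule filterlim_compose)
      moreover have "isCont (eval_fps (fps_shift 1 G)) 0"
        unfolding G_def
        by (rule continuous_eval_fps, rule norm_less_conv_radius) (simp_all add: crB)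
      then have "(eval_fps (fps_shift 1 G) \<longlongrightarrow> eval_fps (fps_shift 1 G) 0) (at_right 0)"
        by (meson at_le isCont_def subset_UNIV tendsto_mono)
      moreover have "((\<lambda>x. (1 - a * x) / (1 - a)) \<longlongrightarrow> (1 - a * 0) / (1 - a)) (at_right 0)"
        by (intro tendsto_intros) (use a in auto)
      ultimately have "((\<lambda>x. (1 - \<psi> x) * eval_fps F (\<psi> x) *
          ((1 - a * x) / (1 - a) * eval_fps (fps_shift 1 G) x)) \<longlongrightarrow>
          0 * ((1 - a * 0) / (1 - a) * eval_fps (fps_shift 1 G) 0)) (at_right 0)"
        by (intro tendsto_mult)
      then have lim: "((\<lambda>x. (1 - \<psi> x) * eval_fps F (\<psi> x) *
          ((1 - a * x) / (1 - a) * eval_fps (fps_shift 1 G) x)) \<longlongrightarrow> 0) (at_right 0)"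
        by simp
      have "\<forall>\<^sub>F x in at_right 0. x \<in> {0<..<1::real}"
        by (rule eventually_at_right_real) simp
      then have "\<forall>\<^sub>F x in at_right 0. (1 - \<psi> x) * eval_fps F (\<psi> x) *
          ((1 - a * x) / (1 - a) * eval_fps (fps_shift 1 G) x) = A i x * B i x"
      proof eventually_elim
        case (elim x)
        then have x: "0 < x" "x < 1" by auto
        have d: "1 - a * x \<noteq> 0" "1 - a \<noteq> 0" using ax[OF x] a by auto
        have "G $ 0 = 0"
          unfolding G_def using i False by (intro polylog_fps_nth_0) (auto simp: n_def)
        then have "B i x = x * eval_fps (fps_shift 1 G) x"
          unfolding B_def G_def[symmetric] using x crB
          by (intro eval_fps_shift_1) (auto simp: G_def)
        moreover have "1 - \<psi> x = (1 - a) * x / (1 - a * x)"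
          using d by (simp add: \<psi>_def field_simps)
        then have "(1 - \<psi> x) * ((1 - a * x) / (1 - a)) = x"
          using d by simp
        ultimately have "A i x * B i x = eval_fps F (\<psi> x) *
            (((1 - \<psi> x) * ((1 - a * x) / (1 - a))) * eval_fps (fps_shift 1 G) x)"
          by (simp add: A_def F_def)
        then show ?case by (simp only: mult_ac)
      qed
      then show ?thesis using False lim by (simp add: Lim_transform_eventually)
    qed
  qed
  then have lim0: "(\<Phi> \<longlongrightarrow> (\<Sum>n. dual_fps a (rev w) $ n)) (at_right 0)"
    by simp

  have "\<forall>\<^sub>F x in at_right 0. x \<in> {0<..<1::real}"
    by (rule eventually_at_right_real) simp
  then have "\<forall>\<^sub>F x in at_right 0. \<Phi> x = \<Phi> (1 / 2)"
    by eventually_elim (rule const)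
  then have "(\<Sum>n. dual_fps a (rev w) $ n) = \<Phi> (1 / 2)"
    by (intro tendsto_unique[OF _ lim0] tendsto_eventually) auto
  moreover have "\<forall>\<^sub>F x in at_left 1. x \<in> {0<..<1::real}"
    by (rule eventually_at_left_real) simp
  then have "\<forall>\<^sub>F x in at_left 1. \<Phi> x = \<Phi> (1 / 2)"
    by eventually_elim (rule const)
  then have "(\<Sum>n. polylog_fps a w $ n) = \<Phi> (1 / 2)"
    by (intro tendsto_unique[OF _ lim1] tendsto_eventually) auto
  ultimately show ?thesis by simp
qed

subsection \<open>Truncated multiple series\<close>

definition trunc_polylog :: "nat list \<Rightarrow> real list \<Rightarrow> nat \<Rightarrow> real" where
  "trunc_polylog s z N =
     (\<Sum>ns\<in>decreasing_indices (length s) N.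
        \<Prod>i<length s. (z ! i) ^ (ns ! i) / real (ns ! i) ^ (s ! i))"

lemma multi_polylog_eq_lim: "multi_polylog s z = lim (trunc_polylog s z)"
  unfolding multi_polylog_def trunc_polylog_def ..

lemma finite_decreasing_indices: "finite (decreasing_indices r N)"
  by (rule finite_subset[OF _ finite_lists_length_eq[of "{1..N}" r]])
    (auto simp: decreasing_indices_def)

lemma decreasing_indices_Suc:
  "decreasing_indices (Suc r) N =
     (\<lambda>(n, ns). n # ns) ` (SIGMA n:{1..N}. decreasing_indices r (n - 1))"
proof (intro set_eqI iffI)
  fix xs assume xs: "xs \<in> decreasing_indices (Suc r) N"
  then obtain n ns where [simp]: "xs = n # ns"
    by (cases xs) (auto simp: decreasing_indices_def)
  have "n \<in> {1..N}" "ns \<in> decreasing_indices r (n - 1)"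
    using xs by (fastforce simp: decreasing_indices_def)+
  then show "xs \<in> (\<lambda>(n, ns). n # ns) ` (SIGMA n:{1..N}. decreasing_indices r (n - 1))"
    by force
next
  fix xs assume "xs \<in> (\<lambda>(n, ns). n # ns) ` (SIGMA n:{1..N}. decreasing_indices r (n - 1))"
  then show "xs \<in> decreasing_indices (Suc r) N"
    by (fastforce simp: decreasing_indices_def)
qed

lemma trunc_polylog_Nil: "trunc_polylog [] z N = 1"
proof -
  have "decreasing_indices 0 N = {[]}" by (auto simp: decreasing_indices_def)
  then show ?thesis by (simp add: trunc_polylog_def)
qed

text \<open>Peeling off the largest index \<open>Suc n\<close> leaves indices at most
  \<open>n\<close>: the strict inequality becomes the truncation point of the inner series.\<close>

lemma trunc_polylog_Cons:
  "trunc_polylog (b # s) (y # z) N =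
     (\<Sum>n<N. y ^ Suc n / real (Suc n) ^ b * trunc_polylog s z n)"
proof -
  define f where "f = (\<lambda>ns. \<Prod>i<length s. (z ! i) ^ (ns ! i) / real (ns ! i) ^ (s ! i))"
  have "trunc_polylog (b # s) (y # z) N =
      (\<Sum>(n, ns)\<in>(SIGMA n:{1..N}. decreasing_indices (length s) (n - 1)). y ^ n / real n ^ b * f ns)"
    unfolding trunc_polylog_def length_Cons decreasing_indices_Suc
    by (subst sum.reindex)
      (auto simp: inj_on_def f_def prod.lessThan_Suc_shift simp del: prod.lessThan_Suc intro!: sum.cong)
  also have "\<dots> = (\<Sum>n=1..N. \<Sum>ns\<in>decreasing_indices (length s) (n - 1). y ^ n / real n ^ b * f ns)"
    by (rule sum.Sigma[symmetric]) (auto intro: finite_decreasing_indices)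
  also have "\<dots> = (\<Sum>n<N. y ^ Suc n / real (Suc n) ^ b * trunc_polylog s z n)"
    by (simp add: sum.atLeast1_atMost_eq sum_distrib_left trunc_polylog_def f_def)
  finally show ?thesis .
qed

text \<open>\<open>c\<close> is the label before the list, 1 at the outset. These quotients are the
  arguments at which the iterated integral of the letters \<open>g dx / (1 - g x)\<close> is a
  multiple polylogarithm with all indices 1.\<close>

fun ratios :: "real \<Rightarrow> real list \<Rightarrow> real list" where
  "ratios c [] = []"
| "ratios c (g # gs) = g / c # ratios g gs"

text \<open>Splitting a power of \<open>c\<close> turns the convolution into a partial sum with
  weights \<open>(1 / c) ^ j\<close>, the source of the denominators in the ratios.\<close>

lemma integral_geo_nth_Suc:
  assumes "c \<noteq> 0"
  shows "fps_integral0 (geo_fps c * F) $ Suc n =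
           c ^ Suc n / real (Suc n) * (\<Sum>j\<le>n. (1 / c) ^ j * F $ j)"
proof -
  have "(geo_fps c * F) $ n = (\<Sum>j\<le>n. F $ j * c ^ Suc (n - j))"
    by (subst mult.commute) (simp add: fps_mult_nth atLeast0AtMost)
  also have "\<dots> = (\<Sum>j\<le>n. c ^ Suc n * ((1 / c) ^ j * F $ j))"
  proof (rule sum.cong[OF refl])
    fix j assume "j \<in> {..n}"
    then have "c ^ Suc n = c ^ Suc (n - j) * c ^ j" by (simp flip: power_add)
    then show "F $ j * c ^ Suc (n - j) = c ^ Suc n * ((1 / c) ^ j * F $ j)"
      using assms by (simp add: power_divide)
  qed
  also have "\<dots> = c ^ Suc n * (\<Sum>j\<le>n. (1 / c) ^ j * F $ j)"
    by (rule sum_distrib_left[symmetric])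
  finally show ?thesis by (simp add: divide_inverse mult_ac del: power_Suc)
qed

text \<open>The weight makes the induction pass: integration against the label \<open>g\<close>
  produces an inner partial sum with weights \<open>(1 / g) ^ j\<close>, which is the hypothesis
  with \<open>g\<close> for \<open>c\<close>. Equality holds for each \<open>N\<close>, so no
  convergence enters.\<close>

lemma trunc_polylog_ratios:
  assumes "c \<noteq> 0" "0 \<notin> set gs"
  shows "trunc_polylog (replicate (length gs) 1) (ratios c gs) N =
           (\<Sum>j\<le>N. (1 / c) ^ j * iter_fps (map geo_fps gs) $ j)"
  using assms
proof (induction gs arbitrary: c N)
  case Nil
  have "(\<Sum>j\<le>N. (1 / c) ^ j * (1 :: real fps) $ j) = (\<Sum>j\<in>{0}. (1 / c) ^ j * (1 :: real fps) $ j)"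
    by (rule sum.mono_neutral_right) auto
  then show ?case by (simp add: trunc_polylog_Nil)
next
  case (Cons g gs)
  define F where "F = iter_fps (map geo_fps gs)"
  have g: "g \<noteq> 0" using Cons.prems by auto
  have "trunc_polylog (replicate (length (g # gs)) 1) (ratios c (g # gs)) N
      = (\<Sum>n<N. (g / c) ^ Suc n / real (Suc n) * (\<Sum>j\<le>n. (1 / g) ^ j * F $ j))"
    using Cons.IH[of g] Cons.prems by (simp add: trunc_polylog_Cons F_def del: power_Suc)
  also have "\<dots> = (\<Sum>n<N. (1 / c) ^ Suc n * fps_integral0 (geo_fps g * F) $ Suc n)"
    by (simp add: integral_geo_nth_Suc[OF g] power_divide del: power_Suc fps_integral_nth_0_Suc)
  also have "\<dots> = (\<Sum>j\<le>N. (1 / c) ^ j * fps_integral0 (geo_fps g * F) $ j)"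
    by (subst sum.atMost_shift) simp
  finally show ?case by (simp add: F_def)
qed

definition index_word :: "nat list \<Rightarrow> form list" where
  "index_word s = concat (map (\<lambda>b. replicate (b - 1) X0 @ [X1]) s)"

lemma polylog_fps_replicate_X0:
  "polylog_fps a (replicate q X0 @ w) $ Suc n = polylog_fps a w $ Suc n / real (Suc n) ^ q"
  by (induction q) (simp_all add: divide_inverse power_inverse)

text \<open>Each \<open>X0\<close> divides coefficient \<open>n\<close> by \<open>n\<close>, and all
  \<open>X1\<close> share the label \<open>a\<close>, so every argument after the first is
  \<open>a / a = 1\<close>. The case distinction is needed because an empty index has no first
  argument.\<close>

lemma trunc_polylog_index_word:
  assumes "c \<noteq> 0" "a \<noteq> 0" "0 \<notin> set s"
  shows "trunc_polylog s (case s of [] \<Rightarrow> [] | _ # t \<Rightarrow> a / c # replicate (length t) 1) N =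
           (\<Sum>j\<le>N. (1 / c) ^ j * polylog_fps a (index_word s) $ j)"
  using assms
proof (induction s arbitrary: c N)
  case Nil
  have "(\<Sum>j\<le>N. (1 / c) ^ j * (1 :: real fps) $ j) = (\<Sum>j\<in>{0}. (1 / c) ^ j * (1 :: real fps) $ j)"
    by (rule sum.mono_neutral_right) auto
  then show ?case by (simp add: trunc_polylog_Nil index_word_def)
next
  case (Cons b s)
  define F where "F = polylog_fps a (index_word s)"
  define G where "G = polylog_fps a (index_word (b # s))"
  obtain q where b: "b = Suc q" using Cons.prems by (cases b) auto
  have G: "G $ Suc n = a ^ Suc n / real (Suc n) ^ b * (\<Sum>j\<le>n. (1 / a) ^ j * F $ j)" for n
  proof -
    have "G $ Suc n = fps_integral0 (geo_fps a * F) $ Suc n / real (Suc n) ^ q"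
      by (simp add: G_def F_def index_word_def b polylog_fps_replicate_X0
          del: fps_integral_nth_0_Suc of_nat_Suc)
    then show ?thesis
      unfolding integral_geo_nth_Suc[OF Cons.prems(2)] by (simp add: b)
  qed
  have G0: "G $ 0 = 0"
    unfolding G_def by (rule polylog_fps_nth_0) (simp add: index_word_def)
  have ones: "replicate (length s) 1 = (case s of [] \<Rightarrow> [] | _ # t \<Rightarrow> a / a # replicate (length t) 1)"
    using Cons.prems by (cases s) auto
  have "trunc_polylog (b # s) (a / c # replicate (length s) 1) N
      = (\<Sum>n<N. (a / c) ^ Suc n / real (Suc n) ^ b * (\<Sum>j\<le>n. (1 / a) ^ j * F $ j))"
    unfolding trunc_polylog_Cons ones F_def using Cons.IH[of a] Cons.prems by simp
  also have "\<dots> = (\<Sum>n<N. (1 / c) ^ Suc n * G $ Suc n)"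
    by (simp add: G power_divide del: power_Suc)
  also have "\<dots> = (\<Sum>j\<le>N. (1 / c) ^ j * G $ j)"
    by (subst sum.atMost_shift) (simp add: G0)
  finally show ?case by (simp add: G_def)
qed

lemma multi_polylog_ratios:
  assumes "0 \<notin> set gs" "summable (\<lambda>n. iter_fps (map geo_fps gs) $ n)"
  shows "multi_polylog (replicate (length gs) 1) (ratios 1 gs)
           = (\<Sum>n. iter_fps (map geo_fps gs) $ n)"
proof -
  have "trunc_polylog (replicate (length gs) 1) (ratios 1 gs)
      = (\<lambda>N. \<Sum>j\<le>N. iter_fps (map geo_fps gs) $ j)"
    using trunc_polylog_ratios[of 1 gs] assms(1) by (simp add: fun_eq_iff)
  then show ?thesis
    unfolding multi_polylog_eq_lim using limI[OF summable_LIMSEQ'[OF assms(2)]] by simp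
qed

lemma multi_polylog1_index_word:
  assumes "\<bar>a\<bar> \<le> 1" "a \<noteq> 1" "a \<noteq> 0" "0 \<notin> set s" "s \<noteq> []"
  shows "multi_polylog1 s a = (\<Sum>n. polylog_fps a (index_word s) $ n)"
proof -
  have "a # replicate (length s - 1) 1 = (case s of [] \<Rightarrow> [] | _ # t \<Rightarrow> a / 1 # replicate (length t) 1)"
    using assms by (cases s) auto
  then have "trunc_polylog s (a # replicate (length s - 1) 1)
      = (\<lambda>N. \<Sum>j\<le>N. polylog_fps a (index_word s) $ j)"
    using trunc_polylog_index_word[of 1 a s] assms by (simp add: fun_eq_iff)
  then show ?thesis
    unfolding multi_polylog1_def multi_polylog_eq_lim
    using limI[OF summable_LIMSEQ'[OF summable_polylog_fps]] assms by simp
qed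

subsection \<open>Expansion of the dual integral\<close>

text \<open>\<open>\<sigma>\<close> records which summand is taken from each difference
  \<open>geo_fps 1 - geo_fps a\<close>; \<open>i\<close> counts the choices already used, so
  \<open>\<sigma>\<close> keeps its global numbering.\<close>

fun labels :: "real \<Rightarrow> (nat \<Rightarrow> real) \<Rightarrow> nat \<Rightarrow> form list \<Rightarrow> real list" where
  "labels a \<sigma> i [] = []"
| "labels a \<sigma> i (X0 # w) = \<sigma> (Suc i) # labels a \<sigma> (Suc i) w"
| "labels a \<sigma> i (X1 # w) = a # labels a \<sigma> i w"

lemma labels_cong:
  "(\<And>j. j > i \<Longrightarrow> \<sigma> j = \<tau> j) \<Longrightarrow> labels a \<sigma> i w = labels a \<tau> i w"
  by (induction a \<sigma> i w rule: labels.induct) auto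

text \<open>Multilinearity: \<open>eta a y / y\<close> is 1 at \<open>y = 1\<close> and -1 at
  \<open>y = a\<close>, the signs in \<open>geo_fps 1 - geo_fps a\<close>. The offset
  \<open>i\<close> is general because the tail of a word uses later entries of
  \<open>\<sigma>\<close>.\<close>

lemma dual_fps_expand:
  assumes a: "a \<noteq> 0" "a \<noteq> 1"
  shows "dual_fps a w =
    (\<Sum>\<sigma> \<in> {Suc i..i + count_list w X0} \<rightarrow>\<^sub>E {1, a}.
       fps_const (\<Prod>j = Suc i..i + count_list w X0. eta a (\<sigma> j) / \<sigma> j) *
       iter_fps (map geo_fps (labels a \<sigma> i w)))"
proof (induction w arbitrary: i)
  case Nil
  then show ?case by simp
next
  case (Cons c w)
  have int: "fps_integral0 (h * (\<Sum>\<sigma>\<in>S. fps_const (f \<sigma>) * g \<sigma>)) =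
      (\<Sum>\<sigma>\<in>S. fps_const (f \<sigma>) * fps_integral0 (h * g \<sigma>))"
    for h :: "real fps" and S :: "(nat \<Rightarrow> real) set" and f g
  proof -
    have "h * (\<Sum>\<sigma>\<in>S. fps_const (f \<sigma>) * g \<sigma>) = (\<Sum>\<sigma>\<in>S. fps_const (f \<sigma>) * (h * g \<sigma>))"
      by (simp add: sum_distrib_left mult_ac)
    then show ?thesis by (simp add: fps_integral0_sum fps_integral0_fps_const_mult_left)
  qed
  show ?case
  proof (cases c)
    case X1
    show ?thesis
      unfolding list.map iter_fps.simps Cons.IH[of i] int X1 by simp
  next
    case X0
    define I where "I = {Suc (Suc i)..Suc i + count_list w X0}"
    define f where "f \<sigma> = (\<Prod>j\<in>I. eta a (\<sigma> j) / \<sigma> j)" for \<sigma>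
    define g where "g \<sigma> = iter_fps (map geo_fps (labels a \<sigma> (Suc i) w))" for \<sigma>
    have IH: "dual_fps a w = (\<Sum>\<sigma>\<in>I \<rightarrow>\<^sub>E {1, a}. fps_const (f \<sigma>) * g \<sigma>)"
      using Cons.IH[of "Suc i"] unfolding I_def f_def g_def .
    have I: "{Suc i..i + count_list (c # w) X0} = insert (Suc i) I" "Suc i \<notin> I"
      by (auto simp: X0 I_def)
    have fin: "finite I" by (simp add: I_def)
    let ?T = "\<lambda>\<sigma>. fps_const (\<Prod>j\<in>insert (Suc i) I. eta a (\<sigma> j) / \<sigma> j) *
       iter_fps (map geo_fps (labels a \<sigma> i (c # w)))"
    have T: "?T (\<sigma>(Suc i := y)) = fps_const (eta a y / y) * (fps_const (f \<sigma>) * fps_integral0 (geo_fps y * g \<sigma>))"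
      for \<sigma> y
    proof -
      have "(\<Prod>j\<in>I. eta a ((\<sigma>(Suc i := y)) j) / (\<sigma>(Suc i := y)) j) = f \<sigma>"
        unfolding f_def using I by (intro prod.cong) auto
      moreover have "labels a (\<sigma>(Suc i := y)) (Suc i) w = labels a \<sigma> (Suc i) w"
        by (rule labels_cong) simp
      ultimately show ?thesis
        using I(2) fin by (simp add: X0 g_def fps_const_mult[symmetric] mult_ac del: fps_const_mult)
    qed
    have "(\<Sum>\<sigma> \<in> insert (Suc i) I \<rightarrow>\<^sub>E {1, a}. ?T \<sigma>)
        = (\<Sum>(y, \<sigma>)\<in>{1, a} \<times> (I \<rightarrow>\<^sub>E {1, a}). ?T (\<sigma>(Suc i := y)))"
      unfolding PiE_insert_eq
      by (subst sum.reindex) (use inj_combinator[OF I(2), of "\<lambda>_. {1, a}"] in \<open>auto simp: case_prod_unfold\<close>)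
    also have "\<dots> = (\<Sum>y\<in>{1, a}. fps_const (eta a y / y) *
        (\<Sum>\<sigma>\<in>I \<rightarrow>\<^sub>E {1, a}. fps_const (f \<sigma>) * fps_integral0 (geo_fps y * g \<sigma>)))"
      unfolding T sum.cartesian_product[symmetric] sum_distrib_left ..
    also have "\<dots> = (\<Sum>y\<in>{1, a}. fps_const (eta a y / y) * fps_integral0 (geo_fps y * dual_fps a w))"
      unfolding IH int ..
    also have "\<dots> = fps_integral0 (geo_fps 1 * dual_fps a w) - fps_integral0 (geo_fps a * dual_fps a w)"
    proof -
      have "fps_const (- 1) * F = - F" for F :: "real fps" by (rule fps_ext) simp
      \<comment> \<open>\<open>a \<noteq> 1\<close> ensures that the sum over \<open>{1, a}\<close>
        really has two terms.\<close>
      then show ?thesis using a by (simp add: eta_def)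
    qed
    also have "\<dots> = dual_fps a (c # w)"
      by (simp add: X0 left_diff_distrib fps_integral0_sub)
    finally show ?thesis unfolding I by simp
  qed
qed

subsection \<open>The words and sequences of the theorem\<close>

lemma labels_append:
  "labels a \<sigma> i (u @ v) = labels a \<sigma> i u @ labels a \<sigma> (i + count_list u X0) v"
  by (induction a \<sigma> i u rule: labels.induct) auto

lemma labels_replicate_X0: "labels a \<sigma> i (replicate q X0) = map \<sigma> [i + 1..<i + q + 1]"
proof (induction q arbitrary: i)
  case (Suc q)
  then show ?case by (simp add: upt_rec[of "Suc i"] del: upt_Suc)
qed simp

lemma labels_replicate_X1: "labels a \<sigma> i (replicate q X1) = replicate q a"
  by (induction q) auto

lemma length_labels: "length (labels a \<sigma> i w) = length w"
  by (induction a \<sigma> i w rule: labels.induct) auto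

lemma set_labels: "set (labels a \<sigma> i w) \<subseteq> insert a (\<sigma> ` {Suc i..i + count_list w X0})"
  by (induction a \<sigma> i w rule: labels.induct) fastforce+

lemma ratios_append: "ratios c (u @ v) = ratios c u @ ratios (last (c # u)) v"
  by (induction c u rule: ratios.induct) auto

lemma ratios_replicate: "a \<noteq> 0 \<Longrightarrow> ratios a (replicate q a) = replicate q 1"
  by (induction q) auto

lemma ratios_map_upt:
  assumes "s < t"
  shows "ratios c (map \<sigma> [s + 1..<t + 1]) =
           \<sigma> (s + 1) / c # map (\<lambda>j. \<sigma> (j + 1) / \<sigma> j) [s + 1..<t]"
  using assms
proof (induction t)
  case (Suc t)
  show ?case
  proof (cases "s = t")
    case False
    then have st: "s < t" using Suc.prems by simp
    have "map \<sigma> [s + 1..<Suc t + 1] = map \<sigma> [s + 1..<t + 1] @ [\<sigma> (t + 1)]"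
      using st by simp
    moreover have "last (c # map \<sigma> [s + 1..<t + 1]) = \<sigma> t"
      using st by simp
    ultimately show ?thesis
      using st by (simp only: ratios_append Suc.IH[OF st] ratios.simps) simp
  qed simp
qed simp

lemma tail_sum_0: "tail_sum k p 0 = 0"
  by (simp add: tail_sum_def)

lemma tail_sum_Suc:
  assumes "i < k"
  shows "tail_sum k p (Suc i) = tail_sum k p i + p (k - i)"
proof -
  have "{k - i..k} = insert (k - i) {k + 1 - i..k}" using assms by auto
  moreover have "k - i \<notin> {k + 1 - i..k}" using assms by auto
  ultimately show ?thesis using assms by (simp add: tail_sum_def)
qed

text \<open>Reversal puts each group of \<open>X1\<close> before a group of \<open>X0\<close>.
  Moving the brackets by one splits off the leading \<open>X1\<close> and lets every block start
  with its \<open>X0\<close>, as in \<open>zseq\<close>.\<close>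

lemma concat_alternate:
  "concat (map (\<lambda>i. f i @ g i) [1..<n + 1]) @ f (n + 1) =
     f 1 @ concat (map (\<lambda>i. g i @ f (i + 1)) [1..<n + 1])"
  by (induction n) auto

section \<open>Block structure of the reversed word\<close>

context
  fixes k :: nat and p m :: "nat \<Rightarrow> nat" and a :: real
  assumes a0: "a \<noteq> 0" and m: "\<forall>i\<in>{2..k + 1}. m i \<ge> 1"
begin

definition dual_block :: "nat \<Rightarrow> form list" where
  "dual_block i = replicate (p (k + 1 - i)) X0 @ replicate (m (k + 1 - i)) X1"

definition label_block :: "(nat \<Rightarrow> real) \<Rightarrow> nat \<Rightarrow> real list" where
  "label_block \<sigma> i =
     map \<sigma> [tail_sum k p (i - 1) + 1..<tail_sum k p i + 1] @ replicate (m (k + 1 - i)) a"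

lemma count_dual_blocks:
  "n \<le> k \<Longrightarrow> count_list (concat (map dual_block [1..<n + 1])) X0 = tail_sum k p n"
proof (induction n)
  case (Suc n)
  have "count_list (replicate q X0) X0 = q" "count_list (replicate q X1) X0 = 0" for q
    by (induction q) auto
  then show ?case using Suc by (simp add: dual_block_def tail_sum_Suc)
qed (simp add: tail_sum_0)

lemma labels_dual_blocks:
  "n \<le> k \<Longrightarrow> labels a \<sigma> 0 (concat (map dual_block [1..<n + 1]))
     = concat (map (label_block \<sigma>) [1..<n + 1])"
proof (induction n)
  case (Suc n)
  have "labels a \<sigma> (tail_sum k p n) (dual_block (Suc n)) = label_block \<sigma> (Suc n)"
    using Suc.prems
    by (simp add: dual_block_def label_block_def labels_append labels_replicate_X0
        labels_replicate_X1 tail_sum_Suc)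
  then show ?case
    using Suc count_dual_blocks[of n] by (simp add: labels_append)
qed simp

text \<open>The last entry of a block is the quotient of the first trailing \<open>a\<close> by its
  predecessor, so the other trailing labels give one 1 fewer than their number. Without a trailing
  \<open>a\<close> that entry is absent, whence \<open>butlast\<close>. If there is no
  \<open>\<sigma>\<close>, the block \<open>[1]\<close> is itself the quotient
  \<open>a / a\<close>.\<close>

lemma ratios_label_block:
  assumes "i \<in> {1..k}"
  shows "ratios a (label_block \<sigma> i) =
     (if m (k + 1 - i) = 0 then butlast (block k p a \<sigma> i)
      else block k p a \<sigma> i @ replicate (m (k + 1 - i) - 1) 1)"
proof -
  obtain j where i: "i = Suc j" "j < k" using assms by (cases i) auto
  define q where "q = m (k + 1 - i)"
  have ts: "tail_sum k p i = tail_sum k p j + p (k + 1 - i)"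
    using tail_sum_Suc[of j k p] i by simp
  show ?thesis
  proof (cases "p (k + 1 - i) = 0")
    case True
    then have "label_block \<sigma> i = replicate q a"
      using ts i by (simp add: label_block_def q_def)
    moreover have "replicate q (1::real) = 1 # replicate (q - 1) 1" if "q \<noteq> 0"
      using that by (cases q) auto
    ultimately show ?thesis
      unfolding q_def[symmetric] using True a0 by (simp add: ratios_replicate block_def)
  next
    case False
    define s t where "s = tail_sum k p j" and "t = tail_sum k p i"
    have st: "s < t" using ts False by (simp add: s_def t_def)
    have lb: "label_block \<sigma> i = map \<sigma> [s + 1..<t + 1] @ replicate q a"
      by (simp add: label_block_def s_def t_def i q_def)
    have blk: "block k p a \<sigma> i = ratios a (map \<sigma> [s + 1..<t + 1]) @ [a / \<sigma> t]"
      unfolding ratios_map_upt[OF st] using False i by (simp add: block_def s_def t_def)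
    have last: "last (a # map \<sigma> [s + 1..<t + 1]) = \<sigma> t" using st by simp
    show ?thesis
    proof (cases q)
      case 0
      then show ?thesis unfolding q_def[symmetric] lb blk by (simp del: upt_Suc)
    next
      case (Suc q')
      then show ?thesis
        unfolding q_def[symmetric] lb blk ratios_append last
        using a0 by (simp add: ratios_replicate)
    qed
  qed
qed

text \<open>Only \<open>m 1\<close> may vanish, and it belongs to block \<open>k\<close>. Each
  earlier block ends in the label \<open>a\<close>, so the next one starts from \<open>a\<close>
  again.\<close>

lemma ratios_label_blocks:
  assumes n: "n < k"
  shows "ratios a (concat (map (label_block \<sigma>) [1..<n + 1])) =
           concat (map (\<lambda>i. block k p a \<sigma> i @ replicate (m (k + 1 - i) - 1) 1) [1..<n + 1])"
    and "last (a # concat (map (label_block \<sigma>) [1..<n + 1])) = a"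
proof -
  have "ratios a (concat (map (label_block \<sigma>) [1..<n + 1])) =
           concat (map (\<lambda>i. block k p a \<sigma> i @ replicate (m (k + 1 - i) - 1) 1) [1..<n + 1]) \<and>
        last (a # concat (map (label_block \<sigma>) [1..<n + 1])) = a"
    using n
  proof (induction n)
    case (Suc n)
    have "k - n \<in> {2..k + 1}" unfolding atLeastAtMost_iff using Suc.prems by arith
    then have "m (k - n) \<ge> 1" using m by blast
    moreover from this have "last (c # label_block \<sigma> (Suc n)) = a" for c
      by (simp add: label_block_def)
    moreover have "ratios a (label_block \<sigma> (Suc n)) =
        block k p a \<sigma> (Suc n) @ replicate (m (k - n) - 1) 1"
      using ratios_label_block[of "Suc n" \<sigma>] calculation Suc.prems by simp
    ultimately show ?case using Suc by (auto simp: ratios_append last_append)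
  qed simp
  then show "ratios a (concat (map (label_block \<sigma>) [1..<n + 1])) =
           concat (map (\<lambda>i. block k p a \<sigma> i @ replicate (m (k + 1 - i) - 1) 1) [1..<n + 1])"
    and "last (a # concat (map (label_block \<sigma>) [1..<n + 1])) = a"
    by auto
qed

lemma rev_index_word_lhs:
  shows "rev (index_word (lhs_index k p m)) =
           replicate (m (k + 1)) X1 @ concat (map dual_block [1..<k + 1])"
proof -
  have ones: "index_word (replicate q 1) = replicate q X1" for q
    by (induction q) (auto simp: index_word_def)
  have app: "index_word (u @ v) = index_word u @ index_word v" for u v
    by (simp add: index_word_def)
  have cc: "index_word (concat xss) = concat (map index_word xss)" for xss
    by (induction xss) (auto simp: app, simp add: index_word_def)
  have "index_word ((p i + 1) # replicate (m (i + 1) - 1) 1)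
      = replicate (p i) X0 @ replicate (m (i + 1)) X1" if "i \<in> {1..k}" for i
  proof -
    have "m (i + 1) \<ge> 1" using that m by auto
    then obtain q where q: "m (i + 1) = Suc q" by (cases "m (i + 1)") auto
    show ?thesis unfolding q using ones[of q] by (simp add: index_word_def)
  qed
  then have "index_word (lhs_index k p m) =
      replicate (m 1) X1 @ concat (map (\<lambda>i. replicate (p i) X0 @ replicate (m (i + 1)) X1) [1..<k + 1])"
    unfolding lhs_index_def app ones cc map_map
    by (intro arg_cong2[where f = "(@)"] arg_cong[where f = concat] map_cong refl) auto
  then have "rev (index_word (lhs_index k p m)) =
      concat (map (\<lambda>i. replicate (m (i + 1)) X1 @ replicate (p i) X0) (rev [1..<k + 1])) @ replicate (m 1) X1"
    by (simp add: rev_concat rev_map o_def del: upt_Suc)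
  also have "rev [1..<k + 1] = map (\<lambda>i. k + 1 - i) [1..<k + 1]"
    by (rule nth_equalityI) (auto simp: rev_nth simp del: upt_Suc)
  also have "concat (map (\<lambda>i. replicate (m (i + 1)) X1 @ replicate (p i) X0)
        (map (\<lambda>i. k + 1 - i) [1..<k + 1])) =
      concat (map (\<lambda>i. replicate (m (k + 2 - i)) X1 @ replicate (p (k + 1 - i)) X0) [1..<k + 1])"
    unfolding map_map
    by (intro arg_cong[where f = concat] map_cong refl) (auto simp: Suc_diff_le)
  \<comment> \<open>The final group is written as the term of index \<open>k + 1\<close> to complete
    the alternating pattern.\<close>
  also have "\<dots> @ replicate (m 1) X1 = \<dots> @ replicate (m (k + 2 - (k + 1))) X1" by simp
  also have "\<dots> = replicate (m (k + 2 - 1)) X1 @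
      concat (map (\<lambda>i. replicate (p (k + 1 - i)) X0 @ replicate (m (k + 2 - (i + 1))) X1) [1..<k + 1])"
    by (rule concat_alternate)
  also have "\<dots> = replicate (m (k + 1)) X1 @ concat (map dual_block [1..<k + 1])"
    by (simp add: dual_block_def[abs_def] del: upt_Suc)
  finally show ?thesis .
qed

lemma zseq_eq_ratios:
  assumes k: "k \<ge> 1"
  shows "zseq k p m a \<sigma> = ratios 1 (labels a \<sigma> 0 (rev (index_word (lhs_index k p m))))"
proof -
  \<comment> \<open>Block \<open>k\<close> is split off because it alone may lack a trailing
    \<open>a\<close>.\<close>
  obtain n where n: "n + 1 = k" using k by (cases k) auto
  then have "n < k" by simp
  have "m (k + 1) \<ge> 1" using k m by auto
  then obtain q where q: "m (k + 1) = Suc q" by (cases "m (k + 1)") auto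
  have "labels a \<sigma> 0 (rev (index_word (lhs_index k p m))) =
      a # replicate q a @ concat (map (label_block \<sigma>) [1..<k + 1])"
  proof -
    have "count_list (replicate (Suc q) X1) X0 = 0" by (induction q) auto
    then show ?thesis
      using labels_dual_blocks[of k \<sigma>] labels_replicate_X1[of a \<sigma> 0 "Suc q"]
      unfolding rev_index_word_lhs q labels_append by (simp del: upt_Suc)
  qed
  also have "ratios 1 \<dots> = a # replicate q 1 @ ratios a (concat (map (label_block \<sigma>) [1..<k + 1]))"
    using a0 by (simp add: ratios_append ratios_replicate del: upt_Suc)
  also have "concat (map (label_block \<sigma>) [1..<k + 1]) =
      concat (map (label_block \<sigma>) [1..<n + 1]) @ label_block \<sigma> k"
    using n by auto
  also have "ratios a \<dots> =
      concat (map (\<lambda>i. block k p a \<sigma> i @ replicate (m (k + 1 - i) - 1) 1) [1..<n + 1]) @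
      ratios a (label_block \<sigma> k)"
    unfolding ratios_append ratios_label_blocks[OF \<open>n < k\<close>] ..
  also have "ratios a (label_block \<sigma> k) = (if m 1 = 0 then butlast (block k p a \<sigma> k)
        else block k p a \<sigma> k @ replicate (m 1 - 1) 1)"
    using ratios_label_block[of k \<sigma>] k by simp
  finally show ?thesis unfolding zseq_def q n by simp
qed

lemma length_index_word_lhs:
  shows "length (index_word (lhs_index k p m)) = (\<Sum>i = 1..k + 1. m i) + (\<Sum>i = 1..k. p i)"
proof -
  have len: "length (concat (map f [1..<n + 1])) = (\<Sum>i = 1..n. length (f i))"
    for f :: "nat \<Rightarrow> form list" and n
    by (induction n) auto
  have "length (index_word (lhs_index k p m)) = length (rev (index_word (lhs_index k p m)))"
    by simp
  also have "\<dots> = m (k + 1) + (\<Sum>i = 1..k. p (k + 1 - i) + m (k + 1 - i))"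
    unfolding rev_index_word_lhs length_append len by (simp add: dual_block_def)
  also have "(\<Sum>i = 1..k. p (k + 1 - i) + m (k + 1 - i)) = (\<Sum>i = 1..k. p i + m i)"
    by (rule sum.reindex_bij_witness[of _ "\<lambda>i. k + 1 - i" "\<lambda>i. k + 1 - i"]) auto
  finally show ?thesis by (simp add: sum.distrib)
qed

lemma count_index_word_lhs:
  shows "count_list (rev (index_word (lhs_index k p m))) X0 = (\<Sum>i = 1..k. p i)"
proof -
  have "count_list (replicate q X1) X0 = 0" for q by (induction q) auto
  then show ?thesis
    unfolding rev_index_word_lhs using count_dual_blocks[of k]
    by (simp add: tail_sum_def del: upt_Suc)
qed

end

theorem theorem2p2:
  fixes k :: nat and p m :: "nat \<Rightarrow> nat" and a :: real and P M :: nat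
  assumes "k \<ge> 1"
    and "\<And>i. i \<in> {2..k + 1} \<Longrightarrow> m i \<ge> 1"
    and "a \<in> {-1..<0} \<union> {0<..<1}"
    and "P = (\<Sum>i = 1..k. p i)"
    and "M = (\<Sum>i = 1..k + 1. m i)"
  shows "multi_polylog1 (lhs_index k p m) a =
    (\<Sum>\<sigma> \<in> {1..P} \<rightarrow>\<^sub>E {1, a}.
       (\<Prod>j = 1..P. eta a (\<sigma> j) / \<sigma> j) *
       multi_polylog (replicate (M + P) 1) (zseq k p m a \<sigma>))"
proof -
  have a: "a \<noteq> 0" "a \<noteq> 1" "\<bar>a\<bar> \<le> 1" "-1 \<le> a" "a < 1" using assms(3) by auto
  have m: "\<forall>i\<in>{2..k + 1}. m i \<ge> 1" using assms(2) by blast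
  define w where "w = index_word (lhs_index k p m)"
  have "m (k + 1) \<ge> 1" using assms(1) m by auto
  \<comment> \<open>The outermost label is therefore \<open>a \<noteq> 1\<close> for every
    \<open>\<sigma>\<close>; this yields convergence even where inner labels equal 1.\<close>
  then obtain v where v: "rev w = X1 # v"
    unfolding w_def rev_index_word_lhs[OF a(1) m] by (cases "m (k + 1)") auto
  then have w: "w \<noteq> []" "last w = X1" by (auto simp: rev_eq_Cons_iff)
  have cnt: "count_list (rev w) X0 = P"
    unfolding w_def assms(4) by (rule count_index_word_lhs[OF a(1) m])
  have len: "length (rev w) = M + P"
    unfolding w_def assms(4,5) using length_index_word_lhs[OF a(1) m] by simp
  define D where "D \<sigma> = iter_fps (map geo_fps (labels a \<sigma> 0 (rev w)))" for \<sigma>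
  have set: "set (labels a \<sigma> 0 u) \<subseteq> {1, a}"
    if "\<sigma> \<in> {1..P} \<rightarrow>\<^sub>E {1, a}" "count_list u X0 = P" for \<sigma> u
    using set_labels[of a \<sigma> 0 u] that by (fastforce simp: PiE_iff)
  have summ: "summable (\<lambda>n. D \<sigma> $ n)" if "\<sigma> \<in> {1..P} \<rightarrow>\<^sub>E {1, a}" for \<sigma>
  proof -
    have "set (labels a \<sigma> 0 v) \<subseteq> {1, a}"
      using set[OF that, of v] cnt v by simp
    then have "sqrt_decay (iter_fps (map geo_fps (labels a \<sigma> 0 v)))"
      using geo_fps_bound[of 1] geo_fps_bound[OF a(3)] by (intro sqrt_decay_iter_fps[of _ 1]) auto
    from summable_integral_geo[OF this a(3,2)] show ?thesis by (simp add: D_def v)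
  qed
  have polylog: "multi_polylog (replicate (M + P) 1) (zseq k p m a \<sigma>) = (\<Sum>n. D \<sigma> $ n)"
    if "\<sigma> \<in> {1..P} \<rightarrow>\<^sub>E {1, a}" for \<sigma>
  proof -
    have "0 \<notin> set (labels a \<sigma> 0 (rev w))"
      using set[OF that cnt] a by auto
    from multi_polylog_ratios[OF this summ[OF that, unfolded D_def]] show ?thesis
      by (simp add: zseq_eq_ratios[OF a(1) m assms(1)] length_labels w_def[symmetric]
          len[simplified] D_def)
  qed
  have "0 \<notin> set (lhs_index k p m)" "lhs_index k p m \<noteq> []"
    using assms(1) by (auto simp: lhs_index_def)
  then have "multi_polylog1 (lhs_index k p m) a = (\<Sum>n. polylog_fps a w $ n)"
    unfolding w_def using a by (intro multi_polylog1_index_word) auto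
  also have "\<dots> = (\<Sum>n. dual_fps a (rev w) $ n)"
    using suminf_polylog_fps_eq_dual[OF a(4,5) w] .
  also have "\<dots> = (\<Sum>n. \<Sum>\<sigma> \<in> {1..P} \<rightarrow>\<^sub>E {1, a}. (\<Prod>j = 1..P. eta a (\<sigma> j) / \<sigma> j) * D \<sigma> $ n)"
    unfolding dual_fps_expand[OF a(1,2), of "rev w" 0] cnt by (simp add: fps_sum_nth D_def)
  also have "\<dots> = (\<Sum>\<sigma> \<in> {1..P} \<rightarrow>\<^sub>E {1, a}. \<Sum>n. (\<Prod>j = 1..P. eta a (\<sigma> j) / \<sigma> j) * D \<sigma> $ n)"
    by (intro suminf_sum summable_mult summ)
  also have "\<dots> = (\<Sum>\<sigma> \<in> {1..P} \<rightarrow>\<^sub>E {1, a}. (\<Prod>j = 1..P. eta a (\<sigma> j) / \<sigma> j) *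
       multi_polylog (replicate (M + P) 1) (zseq k p m a \<sigma>))"
    by (intro sum.cong refl) (simp only: polylog suminf_mult[OF summ])
  finally show ?thesis .
qed

end
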